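(* Let $\mu$ be a probability measure on $[a,b]$ with $\mu\ll\mathscr{L}$ and $0<\operatorname{ess\,inf}\frac{d\mu}{d\mathscr{L}}\le\operatorname{ess\,sup}\frac{d\mu}{d\mathscr{L}}<\infty$. Let $v\in L^1(\mu)$ and let $(\alpha_k)_k$ be a sequence of positive reals with $\alpha_k\to0$. Then $F_{\alpha_k}^{v,\mu}$ $\Gamma$-converges to $F_0^{v,\mu}$ with respect to pointwise convergence on $\mathscr{H}$.
   Context: Fix reals $a<b$; $\mathscr{L}$ is Lebesgue measure. The Helly space is $\mathscr{H}=\{\Phi:[a,b]\to[a,b]\ :\ \Phi \text{ monotone (non-decreasing)},\ \Phi(a)=a,\ \Phi(b)=b\}$ with the topology of pointwise convergence (which is compact and first countable). $\mathsf{Ent}(\nu)=\int \frac{d\nu}{d\mathscr{L}}\log\frac{d\nu}{d\mathscr{L}}\,d\mathscr{L}$ if $\nu\ll\mathscr{L}$ and $+\infty$ otherwise. For $\alpha\geq 0$, $v\in L^1(\mu)$ and $\Phi\in\mathscr{H}$, $F_\alpha^{v,\mu}(\Phi)=\int_a^b\frac{(\Phi(x)-x)^2}{2}\,d\mu(x)+\alpha\,\mathsf{Ent}(\Phi_\#\mu)-\int_a^b\Phi v\,d\mu$, where for $\alpha=0$ the entropy term is absent. Functionals $F_n:X\to\mathbb{R}\cup\{\pm\infty\}$ on a first countable space $X$ $\Gamma$-converge to $F_*$ if (i) for all $x\in X$ and all sequences $x_n\to x$, $F_*(x)\le\liminf_n F_n(x_n)$; and (ii) for every $x\in X$ there is a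 sequence $x_n\to x$ with $F_*(x)\ge\limsup_n F_n(x_n)$. *)

theory Defs
  imports "HOL-Probability.Essential_Supremum" "HOL-Probability.Probability_Measure"
begin

abbreviation leb :: "real \<Rightarrow> real \<Rightarrow> real measure"
  where "leb a b \<equiv> restrict_space lborel {a..b}"

text \<open>The companion of the library's \<^const>\<open>esssup\<close>, with the analogous convention for
  non-measurable functions.\<close>

definition essinf ::
  "'a measure \<Rightarrow> ('a \<Rightarrow> 'b::{second_countable_topology, dense_linorder, linorder_topology, complete_linorder}) \<Rightarrow> 'b"
  where "essinf M f = (if f \<in> borel_measurable M then Liminf (ae_filter M) f else bot)"

text \<open>Functions on \<open>[a,b]\<close> are represented by functions on the real line that are
  \<^const>\<open>undefined\<close> outside \<open>[a,b]\<close>, so that each element of the Helly space has exactly one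
  representative.\<close>

definition helly_set :: "real \<Rightarrow> real \<Rightarrow> (real \<Rightarrow> real) set"
  where "helly_set a b = {\<Phi> \<in> {a..b} \<rightarrow>\<^sub>E {a..b}. mono_on {a..b} \<Phi> \<and> \<Phi> a = a \<and> \<Phi> b = b}"

definition helly_topology :: "real \<Rightarrow> real \<Rightarrow> (real \<Rightarrow> real) topology"
  where "helly_topology a b =
    subtopology (product_topology (\<lambda>_. euclidean) {a..b}) (helly_set a b)"

lemma topspace_helly [simp]: "topspace (helly_topology a b) = helly_set a b"
  by (auto simp: helly_topology_def helly_set_def PiE_def)

lemma limitin_helly:
  assumes "range f \<subseteq> helly_set a b"
  shows "limitin (helly_topology a b) f \<Phi> sequentially \<longleftrightarrow>
    \<Phi> \<in> helly_set a b \<and> (\<forall>x\<in>{a..b}. (\<lambda>n. f n x) \<longlonglongrightarrow> \<Phi> x)"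
proof -
  have "f n \<in> extensional {a..b}" "f n \<in> helly_set a b" for n
    using assms by (auto simp: helly_set_def PiE_def)
  moreover have "\<Phi> \<in> extensional {a..b}" if "\<Phi> \<in> helly_set a b"
    using that by (auto simp: helly_set_def PiE_def)
  ultimately show ?thesis
    unfolding helly_topology_def
    by (auto simp: limitin_subtopology limitin_componentwise PiE_def)
qed

text \<open>The integral of a real-valued function as an extended real; the Bochner integral would be
  \<open>0\<close> where the value should be \<open>\<infinity>\<close>.  In the entropy below the negative part always has finite
  integral, since \<open>t log t \<ge> -1/e\<close> and \<open>[a,b]\<close> has finite measure.\<close>

definition ext_integral :: "'a measure \<Rightarrow> ('a \<Rightarrow> real) \<Rightarrow> ereal"
  where "ext_integral M g =
    enn2ereal (\<integral>\<^sup>+x. ennreal (g x) \<partial>M) - enn2ereal (\<integral>\<^sup>+x. ennreal (- g x) \<partial>M)"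

text \<open>The convention \<open>0 log 0 = 0\<close> is automatic.\<close>

definition Ent :: "real \<Rightarrow> real \<Rightarrow> real measure \<Rightarrow> ereal"
  where "Ent a b \<nu> =
    (if absolutely_continuous (leb a b) \<nu>
     then ext_integral (leb a b)
            (\<lambda>x. let \<rho> = enn2real (RN_deriv (leb a b) \<nu> x) in \<rho> * ln \<rho>)
     else \<infinity>)"

definition F_functional ::
  "real \<Rightarrow> real \<Rightarrow> (real \<Rightarrow> real) \<Rightarrow> real measure \<Rightarrow> real \<Rightarrow> (real \<Rightarrow> real) \<Rightarrow> ereal"
  where "F_functional a b v \<mu> \<alpha> \<Phi> =
    ereal (LINT x|\<mu>. (\<Phi> x - x)\<^sup>2 / 2)
    + (if \<alpha> = 0 then 0 else ereal \<alpha> * Ent a b (distr \<mu> (leb a b) \<Phi>))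
    - ereal (LINT x|\<mu>. \<Phi> x * v x)"

text \<open>Sequential \<open>\<Gamma>\<close>-convergence, intended for first countable \<open>X\<close>.\<close>

definition gamma_converges ::
  "'x topology \<Rightarrow> (nat \<Rightarrow> 'x \<Rightarrow> ereal) \<Rightarrow> ('x \<Rightarrow> ereal) \<Rightarrow> bool"
  where "gamma_converges X F G \<longleftrightarrow>
    (\<forall>x \<in> topspace X. \<forall>s. range s \<subseteq> topspace X \<and> limitin X s x sequentially \<longrightarrow>
        G x \<le> liminf (\<lambda>n. F n (s n))) \<and>
    (\<forall>x \<in> topspace X. \<exists>s. range s \<subseteq> topspace X \<and> limitin X s x sequentially \<and>
        limsup (\<lambda>n. F n (s n)) \<le> G x)"

end

theory Submission
  imports Defs
begin

text \<open>
  Write \<open>F_\<alpha>(\<Phi>) = R(\<Phi>) + \<alpha> Ent(\<Phi>\<^sub># \<mu>)\<close>, where \<open>R = F_0\<close> collects the quadratic and the linear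
  term.  All elements of the Helly space take values in \<open>[a,b]\<close>, so \<open>R\<close> is sequentially continuous
  for pointwise convergence by dominated convergence (\<open>continuous_part_tendsto\<close>).  Everything
  therefore depends on the size of the entropy term.

  \<^item> Lower bound: \<open>t ln t \<ge> -1\<close> gives \<open>Ent \<ge> -(b - a)\<close> for every measure (\<open>Ent_ge\<close>), so along any
    convergent sequence the term \<open>\<alpha>\<^sub>k Ent\<close> is bounded below by a null sequence.

  \<^item> Recovery sequence: a general \<open>\<Phi>\<close> may push mass onto atoms and have infinite entropy.  Mixing in
    the identity, \<open>\<Phi>\<^sub>\<epsilon> = (1 - \<epsilon>) \<Phi> + \<epsilon> id\<close>, keeps it in the Helly space and makes it expand distances
    by at least the factor \<open>\<epsilon>\<close>.  If \<open>C\<close> bounds the density of \<open>\<mu>\<close>, the density of the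
    push-forward is then at most \<open>C / \<epsilon>\<close> (\<open>emeasure_distr_expanding_le\<close>), and a probability density
    bounded by \<open>C / \<epsilon>\<close> has entropy at most \<open>ln (C / \<epsilon>)\<close> (\<open>Ent_le_ln\<close>).  This blows up only
    logarithmically in \<open>1 / \<epsilon>\<close>, so one can let \<open>\<epsilon>\<^sub>k \<longrightarrow> 0\<close> with \<open>\<alpha>\<^sub>k ln (C / \<epsilon>\<^sub>k) \<longrightarrow> 0\<close>; the choice
    \<open>\<epsilon>\<^sub>k = exp (-1 / sqrt \<alpha>\<^sub>k)\<close> makes this quantity equal to \<open>\<alpha>\<^sub>k ln C + sqrt \<alpha>\<^sub>k\<close>.
\<close>

section \<open>Measures dominated by a multiple of another measure\<close>

text \<open>Both sides are countably additive over the connected components of an open set, so the bound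
  extends from connected open sets to open sets, and outer regularity of Lebesgue measure extends it
  to Borel sets.\<close>

lemma emeasure_le_lborel_if_connected_open:
  fixes N :: "'a::euclidean_space measure"
  assumes N: "sets N = sets borel"
    and le: "\<And>S. open S \<Longrightarrow> connected S \<Longrightarrow> emeasure N S \<le> ennreal C * emeasure lborel S"
    and B: "B \<in> sets borel"
  shows "emeasure N B \<le> ennreal C * emeasure lborel B"
proof -
  have open_le: "emeasure N U \<le> ennreal C * emeasure lborel U" if U: "open U" for U
  proof -
    have op: "open S" if "S \<in> components U" for S
      using open_components[OF U that] .
    have cnt: "countable (components U)"
      using countable_disjoint_open_subsets[of "components U"] op pairwise_disjoint_components[of U]
      by (auto simp: pairwise_def disjnt_def disjoint_def)
    have disj: "disjoint_family_on (\<lambda>S. S) (components U)"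
      using pairwise_disjoint_components[of U]
      by (auto simp: disjoint_family_on_def pairwise_def disjnt_def)
    have U_eq: "(\<Union>S\<in>components U. S) = U"
      using Union_components[of U] by simp
    have "emeasure N U = (\<integral>\<^sup>+S. emeasure N S \<partial>count_space (components U))"
      using emeasure_UN_countable[of "components U" "\<lambda>S. S" N, OF _ cnt disj] op N
      by (simp add: U_eq)
    also have "\<dots> \<le> (\<integral>\<^sup>+S. ennreal C * emeasure lborel S \<partial>count_space (components U))"
      by (intro nn_integral_mono le) (auto simp: op dest: in_components_connected)
    also have "\<dots> = ennreal C * (\<integral>\<^sup>+S. emeasure lborel S \<partial>count_space (components U))"
      by (intro nn_integral_cmult) simp
    also have "(\<integral>\<^sup>+S. emeasure lborel S \<partial>count_space (components U)) = emeasure lborel U"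
      using emeasure_UN_countable[of "components U" "\<lambda>S. S" lborel, OF _ cnt disj] op
      by (simp add: U_eq)
    finally show ?thesis .
  qed
  show ?thesis
  proof (rule ennreal_le_epsilon)
    fix e :: real assume e: "0 < e"
    \<comment> \<open>The summand \<open>1\<close> covers \<open>C = 0\<close>.\<close>
    define d where "d = e / (\<bar>C\<bar> + 1)"
    have d: "d > 0" "ennreal C * ennreal d \<le> ennreal e"
    proof -
      show "d > 0" using e by (simp add: d_def)
      have "ennreal C * ennreal d \<le> ennreal \<bar>C\<bar> * ennreal d"
        by (intro mult_right_mono ennreal_leI) auto
      also have "\<dots> = ennreal (\<bar>C\<bar> * d)" using e by (intro ennreal_mult[symmetric]) (auto simp: d_def)
      also have "\<dots> \<le> ennreal e" using e by (intro ennreal_leI) (simp add: d_def field_simps)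
      finally show "ennreal C * ennreal d \<le> ennreal e" .
    qed
    obtain U where U: "open U" "B \<subseteq> U" "emeasure lborel (U - B) < ennreal d"
      using outer_regular_lborel[OF B \<open>d > 0\<close>] .
    have "emeasure lborel U = emeasure lborel (B \<union> (U - B))"
      using U by (intro arg_cong[where f = "emeasure lborel"]) auto
    also have "\<dots> \<le> emeasure lborel B + emeasure lborel (U - B)"
      using U B by (intro emeasure_subadditive) auto
    also have "\<dots> \<le> emeasure lborel B + ennreal d" using U by (intro add_left_mono) auto
    finally have LU: "emeasure lborel U \<le> emeasure lborel B + ennreal d" .
    have "emeasure N B \<le> emeasure N U" using U N by (intro emeasure_mono) auto
    also have "\<dots> \<le> ennreal C * emeasure lborel U" by (rule open_le[OF U(1)])
    also have "\<dots> \<le> ennreal C * (emeasure lborel B + ennreal d)"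
      by (intro mult_left_mono LU) auto
    also have "\<dots> \<le> ennreal C * emeasure lborel B + ennreal e"
      using d by (simp add: distrib_left)
    finally show "emeasure N B \<le> ennreal C * emeasure lborel B + ennreal e" .
  qed
qed

lemma emeasure_le_if_RN_deriv_le:
  assumes M: "sigma_finite_measure M" and ac: "absolutely_continuous M N" and N: "sets N = sets M"
    and le: "AE x in M. RN_deriv M N x \<le> C" and A: "A \<in> sets M"
  shows "emeasure N A \<le> C * emeasure M A"
proof -
  interpret sigma_finite_measure M by fact
  have "emeasure N A = emeasure (density M (RN_deriv M N)) A"
    by (simp add: density_RN_deriv[OF ac N])
  also have "\<dots> = (\<integral>\<^sup>+x. RN_deriv M N x * indicator A x \<partial>M)"
    using A by (simp add: emeasure_density)
  also have "\<dots> \<le> (\<integral>\<^sup>+x. C * indicator A x \<partial>M)"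
    using le by (intro nn_integral_mono_AE) (auto elim!: eventually_mono intro!: mult_right_mono)
  also have "\<dots> = C * emeasure M A" using A by (simp add: nn_integral_cmult_indicator)
  finally show ?thesis .
qed

text \<open>On the set \<open>A\<close> where the density exceeds \<open>C\<close>, the assumed bound leaves no room for the excess:
  its integral over \<open>A\<close> is zero, and being nonnegative it vanishes almost everywhere.\<close>

lemma RN_deriv_le_if_emeasure_le:
  assumes M: "finite_measure M" and N: "sets N = sets M"
    and le: "\<And>A. A \<in> sets M \<Longrightarrow> emeasure N A \<le> ennreal C * emeasure M A"
  shows "absolutely_continuous M N" and "AE x in M. RN_deriv M N x \<le> ennreal C"
proof -
  interpret finite_measure M by fact
  show ac: "absolutely_continuous M N"
  proof (unfold absolutely_continuous_def, rule subsetI)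
    fix A assume "A \<in> null_sets M"
    with le[of A] N show "A \<in> null_sets N" by (auto simp: null_sets_def)
  qed
  let ?f = "RN_deriv M N"
  define A where "A = {x \<in> space M. ennreal C < ?f x}"
  have A[measurable]: "A \<in> sets M" unfolding A_def by measurable
  have "(\<integral>\<^sup>+x. (?f x - ennreal C) * indicator A x \<partial>M) + ennreal C * emeasure M A
      = (\<integral>\<^sup>+x. (?f x - ennreal C) * indicator A x + ennreal C * indicator A x \<partial>M)"
    by (subst nn_integral_add) (auto simp: nn_integral_cmult_indicator)
  also have "\<dots> = (\<integral>\<^sup>+x. ?f x * indicator A x \<partial>M)"
    by (intro nn_integral_cong) (auto simp: A_def split: split_indicator intro: diff_add_cancel_ennreal)
  also have "\<dots> = emeasure N A"
    using emeasure_density[of ?f M A] by (simp add: density_RN_deriv[OF ac N])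
  also have "\<dots> \<le> 0 + ennreal C * emeasure M A" using le[OF A] by simp
  finally have "(\<integral>\<^sup>+x. (?f x - ennreal C) * indicator A x \<partial>M) \<le> 0"
    by (subst (asm) ennreal_add_left_cancel_le | simp add: add.commute ennreal_mult_eq_top_iff)+
  then have "AE x in M. (?f x - ennreal C) * indicator A x = 0"
    by (simp add: nn_integral_0_iff_AE)
  then show "AE x in M. ?f x \<le> ennreal C"
    by (rule AE_mp) (auto intro!: AE_I2 simp: A_def split: split_indicator_asm
        simp: diff_eq_0_iff_ennreal not_less)
qed

section \<open>Entropy bounds\<close>

lemma finite_leb: "finite_measure (leb a b)"
  by (intro finite_measureI) (simp add: emeasure_restrict_space space_restrict_space emeasure_lborel_Icc_eq)

lemma ext_integral_ge:
  assumes "finite_measure M" and "c \<ge> 0" and "\<And>x. x \<in> space M \<Longrightarrow> - c \<le> g x"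
  shows "ereal (- (c * measure M (space M))) \<le> ext_integral M g"
proof -
  interpret finite_measure M by fact
  have "(\<integral>\<^sup>+x. ennreal (- g x) \<partial>M) \<le> (\<integral>\<^sup>+x. ennreal c \<partial>M)"
    using assms by (intro nn_integral_mono ennreal_leI) force
  also have "\<dots> = ennreal (c * measure M (space M))"
    using assms by (simp add: emeasure_eq_measure ennreal_mult)
  finally have "enn2ereal (\<integral>\<^sup>+x. ennreal (- g x) \<partial>M) \<le> ereal (c * measure M (space M))"
    using assms by (metis enn2ereal_ennreal less_eq_ennreal.rep_eq measure_nonneg mult_nonneg_nonneg)
  then have "0 - ereal (c * measure M (space M)) \<le> ext_integral M g"
    unfolding ext_integral_def by (intro ereal_minus_mono) auto
  then show ?thesis by simp
qed

text \<open>The integrand is bounded below by \<open>t ln t \<ge> t - 1 \<ge> -1\<close>, whatever the density.  The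
  constant is not optimal, but any finite one will do for a term multiplied by a null sequence.\<close>

lemma Ent_ge:
  assumes "a \<le> b"
  shows "ereal (- (b - a)) \<le> Ent a b \<nu>"
proof -
  have tlnt: "- 1 \<le> t * ln t" if "t \<ge> 0" for t :: real
  proof (cases "t = 0")
    case False
    then have "t * ln (1 / t) \<le> t * (1 / t - 1)"
      using that by (intro mult_left_mono ln_le_minus_one) auto
    also have "\<dots> = 1 - t" using False by (simp add: right_diff_distrib)
    finally show ?thesis using that False by (simp add: ln_div)
  qed simp
  have "ereal (- (1 * measure (leb a b) (space (leb a b)))) \<le>
      ext_integral (leb a b) (\<lambda>x. let \<rho> = enn2real (RN_deriv (leb a b) \<nu> x) in \<rho> * ln \<rho>)"
    by (intro ext_integral_ge finite_leb) (auto simp: Let_def intro: tlnt)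
  then show ?thesis
    using assms by (simp add: Ent_def space_restrict_space measure_restrict_space)
qed

text \<open>If the density satisfies \<open>\<rho> \<le> C\<close> then \<open>\<rho> ln \<rho> \<le> \<rho> ln C\<close>, and \<open>\<rho>\<close> integrates to one.  With
  \<open>C \<ge> 1\<close> the upper bound is nonnegative, hence it also bounds the positive part of
  \<open>\<rho> ln \<rho>\<close>.\<close>

lemma Ent_le_ln:
  assumes \<nu>: "prob_space \<nu>" "sets \<nu> = sets (leb a b)" and C: "C \<ge> 1"
    and le: "\<And>A. A \<in> sets (leb a b) \<Longrightarrow> emeasure \<nu> A \<le> ennreal C * emeasure (leb a b) A"
  shows "Ent a b \<nu> \<le> ereal (ln C)"
proof -
  interpret L: finite_measure "leb a b" by (rule finite_leb)
  interpret prob_space \<nu> by fact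
  let ?f = "RN_deriv (leb a b) \<nu>"
  have ac: "absolutely_continuous (leb a b) \<nu>" and bound: "AE x in leb a b. ?f x \<le> ennreal C"
    by (rule RN_deriv_le_if_emeasure_le[OF finite_leb \<nu>(2)]; erule le)+
  let ?g = "\<lambda>x. enn2real (?f x) * ln (enn2real (?f x))"
  have "(\<integral>\<^sup>+x. ennreal (?g x) \<partial>leb a b) \<le> (\<integral>\<^sup>+x. ?f x * ennreal (ln C) \<partial>leb a b)"
  proof (intro nn_integral_mono_AE, use bound in eventually_elim)
    fix x assume le: "?f x \<le> ennreal C"
    define r where "r = enn2real (?f x)"
    have r: "?f x = ennreal r" "r \<ge> 0"
      using order.strict_trans1[OF le ennreal_less_top] by (auto simp: r_def)
    have "r \<le> C" using le r C by simp
    then have "r * ln r \<le> r * ln C"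
      using r C by (cases "r = 0") (auto intro!: mult_left_mono)
    then show "ennreal (?g x) \<le> ?f x * ennreal (ln C)"
      using r C by (simp add: ennreal_mult'[symmetric] ennreal_leI)
  qed
  also have "\<dots> = (\<integral>\<^sup>+x. ?f x \<partial>leb a b) * ennreal (ln C)"
    by (intro nn_integral_multc) simp
  also have "(\<integral>\<^sup>+x. ?f x \<partial>leb a b) = 1"
    using L.RN_deriv_nn_integral[OF ac \<nu>(2), of "\<lambda>_. 1"] emeasure_space_1 by simp
  finally have "enn2ereal (\<integral>\<^sup>+x. ennreal (?g x) \<partial>leb a b) \<le> ereal (ln C)"
    using C by (metis enn2ereal_ennreal less_eq_ennreal.rep_eq ln_ge_zero mult_1)
  then have "ext_integral (leb a b) ?g \<le> ereal (ln C) - 0"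
    unfolding ext_integral_def by (intro ereal_minus_mono) auto
  then show ?thesis using ac by (simp add: Ent_def Let_def)
qed


section \<open>Push-forward under an expanding map\<close>

lemma sets_leb: "sets (leb a b) = sets (restrict_space borel {a..b})"
  by (intro sets_restrict_space_cong) simp

lemma emeasure_leb: "A \<in> sets (leb a b) \<Longrightarrow> emeasure (leb a b) A = emeasure lborel A"
  by (subst emeasure_restrict_space) (auto simp: sets_restrict_space)

lemma sets_leb_iff: "A \<in> sets (leb a b) \<longleftrightarrow> A \<in> sets borel \<and> A \<subseteq> {a..b}"
  by (subst sets_restrict_space_iff) auto

text \<open>The preimage \<open>T\<close> of an interval \<open>S\<close> under a map that expands by at least the factor \<open>\<epsilon>\<close> has
  diameter at most \<open>|S| / \<epsilon>\<close>, so it lies in an interval of that length.  That suffices, as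
  the connected open sets of the line are intervals.\<close>

lemma emeasure_distr_expanding_le:
  fixes \<Phi> :: "real \<Rightarrow> real"
  assumes \<mu>: "sets \<mu> = sets (leb a b)" and C: "C > 0" and \<epsilon>: "\<epsilon> > 0"
    and le: "\<And>A. A \<in> sets (leb a b) \<Longrightarrow> emeasure \<mu> A \<le> ennreal C * emeasure (leb a b) A"
    and \<Phi>: "\<Phi> \<in> \<mu> \<rightarrow>\<^sub>M leb a b"
    and expanding: "\<And>x y. a \<le> x \<Longrightarrow> x \<le> y \<Longrightarrow> y \<le> b \<Longrightarrow> \<epsilon> * (y - x) \<le> \<Phi> y - \<Phi> x"
    and A: "A \<in> sets (leb a b)"
  shows "emeasure (distr \<mu> (leb a b) \<Phi>) A \<le> ennreal (C / \<epsilon>) * emeasure (leb a b) A"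
proof -
  have space: "space \<mu> = {a..b}"
    using sets_eq_imp_space_eq[OF \<mu>] by (simp add: space_restrict_space)
  have \<Phi>_borel: "\<Phi> \<in> borel_measurable \<mu>"
    using measurable_restrict_space2_iff[of \<Phi> \<mu> lborel "{a..b}"] \<Phi> by simp
  have "emeasure (distr \<mu> borel \<Phi>) A \<le> ennreal (C / \<epsilon>) * emeasure lborel A"
  proof (rule emeasure_le_lborel_if_connected_open)
    fix S :: "real set" assume S: "open S" "connected S"
    define T where "T = \<Phi> -` S \<inter> {a..b}"
    have T: "T \<in> sets (leb a b)"
      using measurable_sets[OF \<Phi>_borel, of S] S by (simp add: T_def space \<mu>)
    have "emeasure \<mu> T \<le> ennreal (C / \<epsilon>) * emeasure lborel S"
    proof (cases "emeasure lborel S = \<infinity> \<or> T = {}")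
      case True
      then show ?thesis using C \<epsilon> by (auto simp: ennreal_mult_top)
    next
      case False
      define l where "l = measure lborel S"
      have l: "emeasure lborel S = ennreal l" "l \<ge> 0"
        using False by (auto simp: l_def intro: emeasure_eq_ennreal_measure)
      have diam: "y - x \<le> l / \<epsilon>" if "x \<in> T" "y \<in> T" for x y
      proof (cases "x \<le> y")
        case True
        have "0 \<le> \<epsilon> * (y - x)" using True \<epsilon> by simp
        then have "\<Phi> x \<le> \<Phi> y"
          using expanding[of x y] that True by (auto simp: T_def)
        have "{\<Phi> x..\<Phi> y} \<subseteq> S"
          using connected_contains_Icc[OF S(2)] that by (auto simp: T_def)
        then have "emeasure lborel {\<Phi> x..\<Phi> y} \<le> emeasure lborel S"
          using S by (intro emeasure_mono) auto
        then have "\<Phi> y - \<Phi> x \<le> l" using l \<open>\<Phi> x \<le> \<Phi> y\<close> by simp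
        moreover have "\<epsilon> * (y - x) \<le> \<Phi> y - \<Phi> x"
          using expanding[of x y] that True by (auto simp: T_def)
        ultimately show ?thesis using \<epsilon> by (simp add: field_simps)
      qed (use l \<epsilon> in \<open>auto intro: order_trans[of _ 0]\<close>)
      define J where "J = {Inf T..Inf T + l / \<epsilon>}"
      have "T \<subseteq> J"
      proof
        fix y assume y: "y \<in> T"
        have "bdd_below T" by (auto simp: T_def intro: bdd_belowI[of _ a])
        then have "Inf T \<le> y" using y by (rule cInf_lower[rotated])
        moreover have "y - l / \<epsilon> \<le> Inf T"
          using False diam[OF _ y] by (intro cInf_greatest) (auto simp: algebra_simps)
        ultimately show "y \<in> J" by (simp add: J_def)
      qed
      then have "emeasure lborel T \<le> emeasure lborel J"
        by (intro emeasure_mono) (auto simp: J_def)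
      also have "\<dots> = ennreal (l / \<epsilon>)" using l \<epsilon> by (simp add: J_def)
      finally have "ennreal C * emeasure lborel T \<le> ennreal C * ennreal (l / \<epsilon>)"
        by (intro mult_left_mono) auto
      also have "\<dots> = ennreal (C / \<epsilon>) * emeasure lborel S"
        using l C \<epsilon> by (simp add: ennreal_mult'[symmetric])
      finally show ?thesis using le[OF T] by (simp add: emeasure_leb[OF T])
    qed
    then show "emeasure (distr \<mu> borel \<Phi>) S \<le> ennreal (C / \<epsilon>) * emeasure lborel S"
      using S \<Phi>_borel by (simp add: emeasure_distr space T_def)
  qed (use A in \<open>auto simp: sets_leb_iff\<close>)
  then show ?thesis
    using A \<Phi> \<Phi>_borel by (simp add: emeasure_distr emeasure_leb sets_leb_iff)
qed

section \<open>The functional on the Helly space\<close>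

lemma helly_measurable:
  assumes "\<Phi> \<in> helly_set a b" and "sets \<mu> = sets (leb a b)"
  shows "\<Phi> \<in> borel_measurable \<mu>" and "\<Phi> \<in> \<mu> \<rightarrow>\<^sub>M leb a b"
proof -
  have "\<Phi> \<in> borel_measurable (restrict_space borel {a..b})"
    using assms(1) by (intro borel_measurable_mono_on_fnc) (simp add: helly_set_def)
  then show meas: "\<Phi> \<in> borel_measurable \<mu>"
    by (subst measurable_cong_sets[OF _ refl]) (use assms(2) in \<open>simp_all add: sets_leb\<close>)
  have "\<Phi> \<in> space \<mu> \<rightarrow> {a..b}"
    using assms sets_eq_imp_space_eq[OF assms(2)]
    by (auto simp: helly_set_def space_restrict_space)
  with meas show "\<Phi> \<in> \<mu> \<rightarrow>\<^sub>M leb a b" by (simp add: measurable_restrict_space2_iff)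
qed

text \<open>The functional without its entropy term, as a real number; the name refers to
  sequential continuity on the Helly space.\<close>

definition continuous_part :: "real measure \<Rightarrow> (real \<Rightarrow> real) \<Rightarrow> (real \<Rightarrow> real) \<Rightarrow> real" where
  "continuous_part \<mu> v \<Phi> = (LINT x|\<mu>. (\<Phi> x - x)\<^sup>2 / 2) - (LINT x|\<mu>. \<Phi> x * v x)"

lemma F_functional_eq:
  "F_functional a b v \<mu> \<alpha> \<Phi> = ereal (continuous_part \<mu> v \<Phi>) +
     (if \<alpha> = 0 then 0 else ereal \<alpha> * Ent a b (distr \<mu> (leb a b) \<Phi>))"
  unfolding F_functional_def continuous_part_def
  by (cases "ereal \<alpha> * Ent a b (distr \<mu> (leb a b) \<Phi>)") auto

lemma continuous_part_tendsto:
  fixes v :: "real \<Rightarrow> real"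
  assumes "finite_measure \<mu>" and \<mu>: "sets \<mu> = sets (leb a b)" and v: "integrable \<mu> v"
    and s: "\<And>n. s n \<in> helly_set a b" and \<Phi>: "\<Phi> \<in> helly_set a b"
    and lim: "\<And>x. x \<in> {a..b} \<Longrightarrow> (\<lambda>n. s n x) \<longlonglongrightarrow> \<Phi> x"
  shows "(\<lambda>n. continuous_part \<mu> v (s n)) \<longlonglongrightarrow> continuous_part \<mu> v \<Phi>"
proof -
  interpret finite_measure \<mu> by fact
  have space: "space \<mu> = {a..b}"
    using sets_eq_imp_space_eq[OF \<mu>] by (simp add: space_restrict_space)
  note [measurable] = helly_measurable(1)[OF s \<mu>] helly_measurable(1)[OF \<Phi> \<mu>]
    borel_measurable_integrable[OF v]
  have id[measurable]: "(\<lambda>x. x) \<in> borel_measurable \<mu>"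
    by (subst measurable_cong_sets[OF \<mu> refl]) (auto intro: measurable_restrict_space1)
  have range: "s n x \<in> {a..b}" if "x \<in> {a..b}" for n x
    using s[of n] that by (auto simp: helly_set_def)
  have quad: "(\<lambda>n. LINT x|\<mu>. (s n x - x)\<^sup>2 / 2) \<longlonglongrightarrow> (LINT x|\<mu>. (\<Phi> x - x)\<^sup>2 / 2)"
  proof (rule integral_dominated_convergence[where w = "\<lambda>_. (b - a)\<^sup>2 / 2"])
    show "AE x in \<mu>. norm ((s n x - x)\<^sup>2 / 2) \<le> (b - a)\<^sup>2 / 2" for n
    proof (rule AE_I2)
      fix x assume "x \<in> space \<mu>"
      then have "\<bar>s n x - x\<bar> \<le> \<bar>b - a\<bar>" using range[of x n] by (auto simp: space)
      then show "norm ((s n x - x)\<^sup>2 / 2) \<le> (b - a)\<^sup>2 / 2" by (simp add: abs_le_square_iff)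
    qed
    show "AE x in \<mu>. (\<lambda>n. (s n x - x)\<^sup>2 / 2) \<longlonglongrightarrow> (\<Phi> x - x)\<^sup>2 / 2"
      by (intro AE_I2 tendsto_intros lim) (simp_all add: space)
  qed (auto intro!: borel_measurable_divide borel_measurable_power borel_measurable_diff)
  have lin: "(\<lambda>n. LINT x|\<mu>. s n x * v x) \<longlonglongrightarrow> (LINT x|\<mu>. \<Phi> x * v x)"
  proof (rule integral_dominated_convergence[where w = "\<lambda>x. (\<bar>a\<bar> + \<bar>b\<bar>) * \<bar>v x\<bar>"])
    show "AE x in \<mu>. norm (s n x * v x) \<le> (\<bar>a\<bar> + \<bar>b\<bar>) * \<bar>v x\<bar>" for n
    proof (rule AE_I2)
      fix x assume "x \<in> space \<mu>"
      then have "\<bar>s n x\<bar> \<le> \<bar>a\<bar> + \<bar>b\<bar>" using range[of x n] by (auto simp: space)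
      then show "norm (s n x * v x) \<le> (\<bar>a\<bar> + \<bar>b\<bar>) * \<bar>v x\<bar>"
        by (auto simp: abs_mult intro: mult_right_mono)
    qed
    show "AE x in \<mu>. (\<lambda>n. s n x * v x) \<longlonglongrightarrow> \<Phi> x * v x"
      by (intro AE_I2 tendsto_intros lim) (simp add: space)
  qed (measurable, use v in simp)
  show ?thesis unfolding continuous_part_def by (intro tendsto_diff quad lin)
qed

section \<open>Recovery sequences and convergence\<close>

definition tilt :: "real \<Rightarrow> real \<Rightarrow> real \<Rightarrow> (real \<Rightarrow> real) \<Rightarrow> real \<Rightarrow> real" where
  "tilt a b \<epsilon> \<Phi> = (\<lambda>x\<in>{a..b}. (1 - \<epsilon>) * \<Phi> x + \<epsilon> * x)"

lemma tilt_helly: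
  assumes "a \<le> b" and \<epsilon>: "0 \<le> \<epsilon>" "\<epsilon> \<le> 1" and \<Phi>: "\<Phi> \<in> helly_set a b"
  shows "tilt a b \<epsilon> \<Phi> \<in> helly_set a b"
proof -
  have conv: "(1 - \<epsilon>) * u + \<epsilon> * w \<in> {a..b}" if "u \<in> {a..b}" "w \<in> {a..b}" for u w
    using convexD[of "{a..b}" u w "1 - \<epsilon>" \<epsilon>] that \<epsilon> by simp
  have "mono_on {a..b} (tilt a b \<epsilon> \<Phi>)"
  proof (rule mono_onI)
    fix x y assume xy: "x \<in> {a..b}" "y \<in> {a..b}" "x \<le> y"
    then have "\<Phi> x \<le> \<Phi> y" using \<Phi> by (auto simp: helly_set_def elim: mono_onD)
    then show "tilt a b \<epsilon> \<Phi> x \<le> tilt a b \<epsilon> \<Phi> y"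
      using xy \<epsilon> by (auto simp: tilt_def intro!: add_mono mult_left_mono)
  qed
  moreover have "tilt a b \<epsilon> \<Phi> \<in> {a..b} \<rightarrow>\<^sub>E {a..b}"
    unfolding tilt_def by (rule restrict_PiE_iff[THEN iffD2])
      (use \<Phi> conv in \<open>auto simp: helly_set_def PiE_iff\<close>)
  ultimately show ?thesis
    using \<Phi> assms(1) by (auto simp: helly_set_def tilt_def algebra_simps)
qed

text \<open>Since \<open>\<Phi>\<close> is monotone, the summand \<open>\<epsilon> id\<close> alone forces the tilted map to expand by the
  factor \<open>\<epsilon>\<close>, jumps and flat pieces of \<open>\<Phi>\<close> notwithstanding.\<close>

lemma Ent_tilt_le:
  assumes "a \<le> b" and "prob_space \<mu>" and \<mu>: "sets \<mu> = sets (leb a b)" and C: "C \<ge> 1"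
    and \<epsilon>: "0 < \<epsilon>" "\<epsilon> \<le> 1"
    and le: "\<And>A. A \<in> sets (leb a b) \<Longrightarrow> emeasure \<mu> A \<le> ennreal C * emeasure (leb a b) A"
    and \<Phi>: "\<Phi> \<in> helly_set a b"
  shows "Ent a b (distr \<mu> (leb a b) (tilt a b \<epsilon> \<Phi>)) \<le> ereal (ln (C / \<epsilon>))"
proof (rule Ent_le_ln)
  interpret prob_space \<mu> by fact
  have meas: "tilt a b \<epsilon> \<Phi> \<in> \<mu> \<rightarrow>\<^sub>M leb a b"
    using assms by (intro helly_measurable(2) tilt_helly) auto
  show "prob_space (distr \<mu> (leb a b) (tilt a b \<epsilon> \<Phi>))" by (rule prob_space_distr[OF meas])
  show "1 \<le> C / \<epsilon>" using C \<epsilon> by (simp add: field_simps)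
  show "emeasure (distr \<mu> (leb a b) (tilt a b \<epsilon> \<Phi>)) A \<le> ennreal (C / \<epsilon>) * emeasure (leb a b) A"
    if "A \<in> sets (leb a b)" for A
  proof (rule emeasure_distr_expanding_le[OF \<mu> _ \<epsilon>(1) le meas _ that])
    fix x y assume xy: "a \<le> x" "x \<le> y" "y \<le> b"
    then have "(1 - \<epsilon>) * \<Phi> x \<le> (1 - \<epsilon>) * \<Phi> y"
      using \<Phi> \<epsilon> by (intro mult_left_mono) (auto simp: helly_set_def elim: mono_onD)
    then show "\<epsilon> * (y - x) \<le> tilt a b \<epsilon> \<Phi> y - tilt a b \<epsilon> \<Phi> x"
      using xy by (simp add: tilt_def algebra_simps)
  qed (use C in auto)
qed simp

theorem theorem3p3:
  fixes a b :: real and \<mu> :: "real measure" and v :: "real \<Rightarrow> real" and \<alpha> :: "nat \<Rightarrow> real"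
  assumes "a < b"
    and "prob_space \<mu>" and "sets \<mu> = sets (restrict_space borel {a..b})"
    and "absolutely_continuous (leb a b) \<mu>"
    and "0 < essinf (leb a b) (RN_deriv (leb a b) \<mu>)"
    and "essinf (leb a b) (RN_deriv (leb a b) \<mu>) \<le> esssup (leb a b) (RN_deriv (leb a b) \<mu>)"
    and "esssup (leb a b) (RN_deriv (leb a b) \<mu>) < \<infinity>"
    and "integrable \<mu> v"
    and "\<And>k. 0 < \<alpha> k" and "\<alpha> \<longlonglongrightarrow> 0"
  shows "gamma_converges (helly_topology a b)
           (\<lambda>k. F_functional a b v \<mu> (\<alpha> k)) (F_functional a b v \<mu> 0)"
proof -
  interpret L: finite_measure "leb a b" by (rule finite_leb)
  interpret prob_space \<mu> by fact
  have \<mu>: "sets \<mu> = sets (leb a b)" using assms(3) by (simp add: sets_leb)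
  note continuous_part_lim = continuous_part_tendsto[OF finite_measure_axioms \<mu> \<open>integrable \<mu> v\<close>]
  have \<alpha>0: "\<alpha> n \<noteq> 0" for n using assms(9)[of n] by simp
  \<comment> \<open>The maximum with \<open>1\<close> provides the nonnegative logarithm that the entropy bound asks for.\<close>
  define C where "C = max 1 (enn2real (esssup (leb a b) (RN_deriv (leb a b) \<mu>)))"
  have C: "C \<ge> 1" by (simp add: C_def)
  have \<mu>_le: "emeasure \<mu> A \<le> ennreal C * emeasure (leb a b) A" if "A \<in> sets (leb a b)" for A
  proof (rule emeasure_le_if_RN_deriv_le[OF L.sigma_finite_measure_axioms assms(4) \<mu> _ that])
    have "esssup (leb a b) (RN_deriv (leb a b) \<mu>)
        = ennreal (enn2real (esssup (leb a b) (RN_deriv (leb a b) \<mu>)))"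
      using assms(7) by simp
    also have "\<dots> \<le> ennreal C" by (intro ennreal_leI) (simp add: C_def)
    finally show "AE x in leb a b. RN_deriv (leb a b) \<mu> x \<le> ennreal C"
      using esssup_AE[where f = "RN_deriv (leb a b) \<mu>" and M = "leb a b"] by (auto elim!: eventually_mono)
  qed
  show ?thesis
    unfolding gamma_converges_def topspace_helly
  proof (intro conjI ballI allI impI)
    fix \<Phi> s
    assume \<Phi>: "\<Phi> \<in> helly_set a b"
      and s: "range s \<subseteq> helly_set a b \<and> limitin (helly_topology a b) s \<Phi> sequentially"
    have "(\<lambda>n. continuous_part \<mu> v (s n)) \<longlonglongrightarrow> continuous_part \<mu> v \<Phi>"
      using s limitin_helly[of s] by (intro continuous_part_lim \<Phi>) auto
    then have "(\<lambda>n. continuous_part \<mu> v (s n) - \<alpha> n * (b - a)) \<longlonglongrightarrow> continuous_part \<mu> v \<Phi> - 0 * (b - a)"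
      by (intro tendsto_intros assms(10))
    then have "(\<lambda>n. ereal (continuous_part \<mu> v (s n) - \<alpha> n * (b - a))) \<longlonglongrightarrow> ereal (continuous_part \<mu> v \<Phi>)"
      by simp
    then have "ereal (continuous_part \<mu> v \<Phi>)
        = liminf (\<lambda>n. ereal (continuous_part \<mu> v (s n) - \<alpha> n * (b - a)))"
      by (intro lim_imp_Liminf[symmetric]) auto
    also have "\<dots> \<le> liminf (\<lambda>n. F_functional a b v \<mu> (\<alpha> n) (s n))"
    proof (intro Liminf_mono always_eventually allI)
      fix n
      have "ereal (\<alpha> n) * ereal (- (b - a)) \<le> ereal (\<alpha> n) * Ent a b (distr \<mu> (leb a b) (s n))"
        using assms(1) assms(9)[of n] by (intro ereal_mult_left_mono Ent_ge) (auto simp: less_imp_le)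
      then have "ereal (continuous_part \<mu> v (s n)) + ereal (\<alpha> n) * ereal (- (b - a))
          \<le> ereal (continuous_part \<mu> v (s n)) + ereal (\<alpha> n) * Ent a b (distr \<mu> (leb a b) (s n))"
        by (rule add_left_mono)
      also have "\<dots> = F_functional a b v \<mu> (\<alpha> n) (s n)"
        using \<alpha>0 by (simp add: F_functional_eq)
      finally show "ereal (continuous_part \<mu> v (s n) - \<alpha> n * (b - a))
          \<le> F_functional a b v \<mu> (\<alpha> n) (s n)" by (simp add: algebra_simps)
    qed
    finally show "F_functional a b v \<mu> 0 \<Phi> \<le> liminf (\<lambda>n. F_functional a b v \<mu> (\<alpha> n) (s n))"
      by (simp add: F_functional_eq)
  next
    fix \<Phi> assume \<Phi>: "\<Phi> \<in> helly_set a b"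
    \<comment> \<open>Slow enough for \<open>\<alpha>\<^sub>n ln (1 / \<epsilon>\<^sub>n) = sqrt \<alpha>\<^sub>n\<close> to vanish, yet \<open>\<epsilon>\<^sub>n\<close> itself tends to zero.\<close>
    define \<epsilon> where "\<epsilon> n = exp (- (1 / sqrt (\<alpha> n)))" for n
    have \<epsilon>: "0 < \<epsilon> n" "\<epsilon> n \<le> 1" for n using assms(9)[of n] by (auto simp: \<epsilon>_def)
    have sqrt0: "(\<lambda>n. sqrt (\<alpha> n)) \<longlonglongrightarrow> 0"
      using tendsto_real_sqrt[OF assms(10)] by simp
    have "filterlim (\<lambda>n. sqrt (\<alpha> n)) (at_right 0) sequentially"
      using sqrt0 assms(9) by (intro tendsto_imp_filterlim_at_right) auto
    then have "filterlim (\<lambda>n. 1 / sqrt (\<alpha> n)) at_top sequentially"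
      using filterlim_compose[OF filterlim_inverse_at_top_right] by (simp add: field_simps)
    then have \<epsilon>0: "\<epsilon> \<longlonglongrightarrow> 0"
      unfolding \<epsilon>_def by (intro filterlim_compose[OF exp_at_bot] filterlim_uminus_at_bot_at_top
          [THEN filterlim_compose])
    define s where "s n = tilt a b (\<epsilon> n) \<Phi>" for n
    have s: "s n \<in> helly_set a b" for n
      unfolding s_def using assms(1) \<epsilon>[of n] \<Phi> by (intro tilt_helly) auto
    have lim: "(\<lambda>n. s n x) \<longlonglongrightarrow> \<Phi> x" if "x \<in> {a..b}" for x
    proof -
      have "(\<lambda>n. (1 - \<epsilon> n) * \<Phi> x + \<epsilon> n * x) \<longlonglongrightarrow> (1 - 0) * \<Phi> x + 0 * x"
        by (intro tendsto_intros \<epsilon>0)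
      then show ?thesis using that by (simp add: s_def tilt_def)
    qed
    have "limsup (\<lambda>n. F_functional a b v \<mu> (\<alpha> n) (s n)) \<le> F_functional a b v \<mu> 0 \<Phi>"
    proof -
      have "limsup (\<lambda>n. F_functional a b v \<mu> (\<alpha> n) (s n))
          \<le> limsup (\<lambda>n. ereal (continuous_part \<mu> v (s n) + (\<alpha> n * ln C + sqrt (\<alpha> n))))"
      proof (intro Limsup_mono always_eventually allI)
        fix n
        have "ereal (\<alpha> n) * Ent a b (distr \<mu> (leb a b) (s n)) \<le> ereal (\<alpha> n) * ereal (ln (C / \<epsilon> n))"
          unfolding s_def using assms(1,2) assms(9)[of n] \<mu> C \<epsilon>[of n] \<mu>_le \<Phi>
          by (intro ereal_mult_left_mono Ent_tilt_le) auto
        also have "ln (C / \<epsilon> n) = ln C + 1 / sqrt (\<alpha> n)"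
          using C by (simp add: \<epsilon>_def ln_div)
        also have "ereal (\<alpha> n) * ereal (ln C + 1 / sqrt (\<alpha> n)) = ereal (\<alpha> n * ln C + sqrt (\<alpha> n))"
          using real_div_sqrt[of "\<alpha> n"] assms(9)[of n] by (simp add: distrib_left)
        finally have "ereal (continuous_part \<mu> v (s n)) + ereal (\<alpha> n) * Ent a b (distr \<mu> (leb a b) (s n))
            \<le> ereal (continuous_part \<mu> v (s n)) + ereal (\<alpha> n * ln C + sqrt (\<alpha> n))"
          by (rule add_left_mono)
        then show "F_functional a b v \<mu> (\<alpha> n) (s n)
            \<le> ereal (continuous_part \<mu> v (s n) + (\<alpha> n * ln C + sqrt (\<alpha> n)))"
          using \<alpha>0 by (simp add: F_functional_eq)
      qed
      also have "\<dots> = ereal (continuous_part \<mu> v \<Phi>)"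
      proof (rule lim_imp_Limsup)
        have "(\<lambda>n. continuous_part \<mu> v (s n) + (\<alpha> n * ln C + sqrt (\<alpha> n)))
            \<longlonglongrightarrow> continuous_part \<mu> v \<Phi> + (0 * ln C + 0)"
          by (intro tendsto_intros continuous_part_lim s \<Phi> lim assms(10) sqrt0)
        then show "(\<lambda>n. ereal (continuous_part \<mu> v (s n) + (\<alpha> n * ln C + sqrt (\<alpha> n))))
            \<longlonglongrightarrow> ereal (continuous_part \<mu> v \<Phi>)" by simp
      qed simp
      finally show ?thesis by (simp add: F_functional_eq)
    qed
    moreover have "range s \<subseteq> helly_set a b" using s by auto
    moreover from this have "limitin (helly_topology a b) s \<Phi> sequentially"
      using \<Phi> lim by (subst limitin_helly) auto
    ultimately show "\<exists>s. range s \<subseteq> helly_set a b \<and> limitin (helly_topology a b) s \<Phi> sequentially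
        \<and> limsup (\<lambda>n. F_functional a b v \<mu> (\<alpha> n) (s n)) \<le> F_functional a b v \<mu> 0 \<Phi>"
      by blast
  qed
qed

end
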